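(* For every positive integer $n$ we have $l_n\geq \frac{1}{2\sqrt{n}}$.
   Context: For a real orthogonal $n\times n$ matrix $M=(m_{i,j})$ let $l_M:=\min_{1\le i,j\le n}|m_{i,j}|$, and let $l_n:=\max_{M\in O(n)} l_M$, where $O(n)$ denotes the group of real orthogonal $n\times n$ matrices. *)

theory Defs
  imports "HOL-Analysis.Analysis"
begin

definition min_abs_entry :: "real^'n::finite^'n \<Rightarrow> real" where
  "min_abs_entry M = Min {\<bar>M $ i $ j\<bar> | i j. True}"

text \<open>l_n: the maximum of l_M over all real orthogonal n x n matrices, where n = CARD('n).
  The maximum is attained (O(n) is compact), so it coincides with the supremum.\<close>
definition l_max :: "'n::finite itself \<Rightarrow> real" where
  "l_max _ = (SUP M \<in> {M :: real^'n^'n. orthogonal_matrix M}. min_abs_entry M)"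

end

theory Submission
  imports Defs
begin

text \<open>
  Let \<open>M\<close> maximise the entrywise 1-norm over \<open>O(n)\<close> and let \<open>S\<close> be its sign matrix.  For every
  orthogonal \<open>N\<close> and every sign matrix \<open>T\<close> we have \<open>\<langle>T, N\<rangle> \<le> \<parallel>N\<parallel>\<^sub>1 \<le> \<parallel>M\<parallel>\<^sub>1 = \<langle>S, M\<rangle>\<close>.  Fix \<open>i, j\<close> and
  take for \<open>N\<close> the matrix obtained by rotating the rows of \<open>M\<close> in the plane spanned by the \<open>j\<close>-th
  unit vector and the \<open>i\<close>-th row of \<open>M\<close>.  The choice \<open>T = S\<close> yields a symmetry property of
  \<open>S\<^sup>T M\<close> on that plane, and then flipping the entry \<open>(i, j)\<close> of \<open>S\<close> and optimising the angle yields
  \<open>m (r + c) \<ge> 1 + m\<^sup>2\<close>, where \<open>m = \<bar>M\<^sub>i\<^sub>j\<bar>\<close> and \<open>r, c \<le> \<surd>n\<close> are the 1-norms of row \<open>i\<close> and column \<open>j\<close>.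
\<close>

definition l1_norm :: "real^'n::finite^'m::finite \<Rightarrow> real" where
  "l1_norm M = (\<Sum>i\<in>UNIV. \<Sum>j\<in>UNIV. \<bar>M $ i $ j\<bar>)"

definition sign_matrix :: "real^'n::finite^'m::finite \<Rightarrow> bool" where
  "sign_matrix S \<longleftrightarrow> (\<forall>i j. \<bar>S $ i $ j\<bar> = 1)"

text \<open>For orthonormal \<open>e\<close>, \<open>u\<close> and c^2 + s^2 = 1 this is the
  rotation sending \<open>e\<close> to c e + s u and \<open>u\<close> to c u - s e, and fixing the
  orthogonal complement of their plane. The pair (c, s) replaces an angle.\<close>

definition plane_rot :: "real \<Rightarrow> real \<Rightarrow> 'a \<Rightarrow> 'a \<Rightarrow> 'a::real_inner \<Rightarrow> 'a" where
  "plane_rot c s e u x =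
     x + ((c - 1) * (e \<bullet> x) - s * (u \<bullet> x)) *\<^sub>R e + ((c - 1) * (u \<bullet> x) + s * (e \<bullet> x)) *\<^sub>R u"

lemma inner_plane_rot:
  assumes "e \<bullet> e = 1" "u \<bullet> u = 1" "e \<bullet> u = 0" "c\<^sup>2 + s\<^sup>2 = 1"
  shows "plane_rot c s e u x \<bullet> plane_rot c s e u y = x \<bullet> y"
proof -
  have ue: "u \<bullet> e = 0"
    using assms(3) by (simp add: inner_commute)
  have s2: "s * s = 1 - c * c"
    using assms(4) by (simp add: power2_eq_square)
  define a b a' b' where ab: "a = e \<bullet> x" "b = u \<bullet> x" "a' = e \<bullet> y" "b' = u \<bullet> y"
  have comm: "x \<bullet> e = a" "x \<bullet> u = b"
    unfolding ab by (simp_all add: inner_commute)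
  have "plane_rot c s e u x \<bullet> plane_rot c s e u y - x \<bullet> y
      = (c * c + s * s - 1) * (a * a' + b * b')"
    unfolding plane_rot_def ab[symmetric]
    by (simp add: inner_add_left inner_add_right assms ue comm ab[symmetric]) (simp add: algebra_simps)
  then show ?thesis
    by (simp add: s2)
qed

lemma orthogonal_matrix_iff_rows:
  fixes M :: "real^'n::finite^'n"
  shows "orthogonal_matrix M \<longleftrightarrow> (\<forall>i j. M $ i \<bullet> M $ j = (if i = j then 1 else 0))"
  unfolding orthogonal_matrix_orthonormal_rows
  by (auto simp: row_def orthogonal_def norm_eq_1)

lemma orthogonal_matrix_plane_rot:
  fixes M :: "real^'n::finite^'n"
  assumes "orthogonal_matrix M" "e \<bullet> e = 1" "u \<bullet> u = 1" "e \<bullet> u = 0" "c\<^sup>2 + s\<^sup>2 = 1"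
  shows "orthogonal_matrix (\<chi> l. plane_rot c s e u (M $ l))"
  using assms by (simp add: orthogonal_matrix_iff_rows inner_plane_rot)

lemma abs_entry_le_1:
  fixes M :: "real^'n::finite^'n"
  assumes "orthogonal_matrix M"
  shows "\<bar>M $ i $ j\<bar> \<le> 1"
proof -
  have "norm (M $ i) = 1"
    using assms by (simp add: orthogonal_matrix_iff_rows norm_eq_1)
  then show ?thesis
    using component_le_norm_cart[of "M $ i" j] by simp
qed

lemma compact_orthogonal_matrices:
  "compact {M :: real^'n::finite^'n. orthogonal_matrix M}"
proof -
  have "closed {M :: real^'n^'n. orthogonal_matrix M}"
    unfolding orthogonal_matrix_iff_rows
    by (intro closed_Collect_all closed_Collect_eq continuous_intros)
  moreover have "norm M \<le> real CARD('n)" if "orthogonal_matrix M" for M :: "real^'n^'n"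
  proof -
    have "norm M \<le> (\<Sum>i\<in>UNIV. norm (M $ i))"
      unfolding norm_vec_def[of M] by (rule L2_set_le_sum) simp
    also have "\<dots> = real CARD('n)"
      using that by (simp add: orthogonal_matrix_iff_rows norm_eq_1[THEN iffD2])
    finally show ?thesis .
  qed
  ultimately show ?thesis
    by (auto simp: compact_eq_bounded_closed bounded_iff)
qed

lemma ex_l1_norm_maximizer:
  obtains M :: "real^'n::finite^'n" where "orthogonal_matrix M"
    "\<And>N :: real^'n^'n. orthogonal_matrix N \<Longrightarrow> l1_norm N \<le> l1_norm M"
proof -
  have "continuous_on {M :: real^'n^'n. orthogonal_matrix M} l1_norm"
    unfolding l1_norm_def by (intro continuous_intros)
  moreover have "{M :: real^'n^'n. orthogonal_matrix M} \<noteq> {}"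
    using orthogonal_matrix_id by blast
  ultimately show thesis
    using continuous_attains_sup[OF compact_orthogonal_matrices] that by auto
qed

lemma sign_matrix_pairing_le:
  assumes "sign_matrix S"
  shows "(\<Sum>l\<in>UNIV. S $ l \<bullet> N $ l) \<le> l1_norm N"
  unfolding l1_norm_def inner_vec_def
proof (intro sum_mono)
  fix l k
  have "S $ l $ k \<bullet> N $ l $ k \<le> \<bar>S $ l $ k\<bar> * \<bar>N $ l $ k\<bar>"
    by (simp add: abs_mult[symmetric])
  then show "S $ l $ k \<bullet> N $ l $ k \<le> \<bar>N $ l $ k\<bar>"
    using assms by (simp add: sign_matrix_def)
qed

text \<open>Cauchy-Schwarz against a vector of signs; it bounds the 1-norm of a row or column of an
  orthogonal matrix.\<close>

lemma sum_signs_le: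
  fixes s x :: "real^'n::finite"
  assumes "\<And>k. \<bar>s $ k\<bar> = 1" "norm x = 1"
  shows "s \<bullet> x \<le> sqrt (real CARD('n))"
proof -
  have "norm s = sqrt (real CARD('n))"
    using assms(1) by (simp add: norm_vec_def L2_set_def)
  then show ?thesis
    using norm_cauchy_schwarz[of s x] assms(2) by simp
qed

text \<open>The linear form attains its maximum sqrt(B^2 + C^2) over the unit circle at (B, C) / D,
  a point that exists only if (B, C) is nonzero.\<close>

lemma trig_bound_imp_squares:
  fixes A B C :: real
  assumes "\<And>c s. c\<^sup>2 + s\<^sup>2 = 1 \<Longrightarrow> B * c + C * s \<le> A"
  shows "B\<^sup>2 + C\<^sup>2 \<le> A\<^sup>2"
proof (cases "B\<^sup>2 + C\<^sup>2 = 0")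
  case False
  define D where "D = sqrt (B\<^sup>2 + C\<^sup>2)"
  have D2: "D\<^sup>2 = B\<^sup>2 + C\<^sup>2"
    by (simp add: D_def)
  have D: "D > 0"
    using False unfolding D_def by (metis real_sqrt_gt_0_iff sum_power2_ge_zero order_less_le)
  have "B * (B / D) + C * (C / D) \<le> A"
    by (rule assms) (use False D2 in \<open>simp add: power_divide flip: add_divide_distrib\<close>)
  moreover have "B * (B / D) + C * (C / D) = D\<^sup>2 / D"
    unfolding D2 by (simp add: power2_eq_square add_divide_distrib)
  ultimately have "D \<le> A"
    using D by (simp add: power2_eq_square)
  then show ?thesis
    using D D2 by (metis less_imp_le power_mono)
qed simp

context
  fixes M S :: "real^'n::finite^'n"
begin

text \<open>The bilinear form of the matrix S^T M.\<close>

definition cross_form :: "real^'n \<Rightarrow> real^'n \<Rightarrow> real" where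
  "cross_form x y = (\<Sum>l\<in>UNIV. (x \<bullet> S $ l) * (y \<bullet> M $ l))"

lemma cross_form_linear:
  "cross_form (x + x') y = cross_form x y + cross_form x' y"
  "cross_form (x - x') y = cross_form x y - cross_form x' y"
  "cross_form x (y + y') = cross_form x y + cross_form x y'"
  "cross_form x (y - y') = cross_form x y - cross_form x y'"
  "cross_form (a *\<^sub>R x) y = a * cross_form x y"
  "cross_form x (a *\<^sub>R y) = a * cross_form x y"
  unfolding cross_form_def
  by (simp_all add: inner_add_left inner_diff_left algebra_simps sum.distrib sum_subtractf
      sum_distrib_left)

text \<open>Since M M^T is the identity, S^T M sends row i of M to row i of S.\<close>

lemma cross_form_row:
  assumes "orthogonal_matrix M"
  shows "cross_form x (M $ i) = x \<bullet> S $ i"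
proof -
  have "(x \<bullet> S $ l) * (M $ i \<bullet> M $ l) = (if l = i then x \<bullet> S $ l else 0)" for l
    using assms by (auto simp: orthogonal_matrix_iff_rows)
  then show ?thesis
    unfolding cross_form_def by (simp only: sum.delta finite UNIV_I if_True)
qed

text \<open>Only the restriction of S^T M to the plane matters: its trace goes with c - 1, its
  antisymmetric part with s.\<close>

lemma pairing_plane_rot:
  "(\<Sum>l\<in>UNIV. S $ l \<bullet> plane_rot c s e u (M $ l)) =
     (\<Sum>l\<in>UNIV. S $ l \<bullet> M $ l) + (c - 1) * (cross_form e e + cross_form u u)
       + s * (cross_form u e - cross_form e u)"
proof -
  have "S $ l \<bullet> plane_rot c s e u (M $ l) = S $ l \<bullet> M $ l
      + (c - 1) * ((e \<bullet> S $ l) * (e \<bullet> M $ l) + (u \<bullet> S $ l) * (u \<bullet> M $ l))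
      + s * ((u \<bullet> S $ l) * (e \<bullet> M $ l) - (e \<bullet> S $ l) * (u \<bullet> M $ l))" for l
    unfolding plane_rot_def
    by (simp add: inner_add_right inner_commute[of "S $ l" e] inner_commute[of "S $ l" u])
       (simp add: algebra_simps)
  then show ?thesis
    by (simp add: cross_form_def sum.distrib sum_subtractf flip: sum_distrib_left)
qed

end

lemma maximizer_entry_bound:
  fixes M :: "real^'n::finite^'n"
  assumes orth: "orthogonal_matrix M"
    and max: "\<And>N :: real^'n^'n. orthogonal_matrix N \<Longrightarrow> l1_norm N \<le> l1_norm M"
  shows "1 / (2 * sqrt (real CARD('n))) \<le> \<bar>M $ i $ j\<bar>"
proof -
  \<comment> \<open>Not \<open>sgn\<close>: zero entries of \<open>M\<close> must also receive a sign.\<close>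
  define S :: "real^'n^'n" where "S = (\<chi> k l. if M $ k $ l < 0 then -1 else 1)"
  define T :: "real^'n^'n" where "T = (\<chi> k l. if k = i \<and> l = j then - S $ k $ l else S $ k $ l)"
  define \<sigma> where "\<sigma> = S $ i $ j"
  define m where "m = \<bar>M $ i $ j\<bar>"
  define e :: "real^'n" where "e = axis j 1"
  \<comment> \<open>The sign makes the inner product of \<open>e\<close> and \<open>v\<close> equal
    to m, hence nonnegative.\<close>
  define v where "v = \<sigma> *\<^sub>R (M $ i)"
  define P where "P = cross_form M S"
  have S1: "\<bar>S $ k $ l\<bar> = 1" and SM: "S $ k $ l * M $ k $ l = \<bar>M $ k $ l\<bar>" for k l
    by (simp_all add: S_def)
  have signS: "sign_matrix S" and signT: "sign_matrix T"
    by (simp_all add: sign_matrix_def T_def S1)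
  have pairM: "(\<Sum>l\<in>UNIV. S $ l \<bullet> M $ l) = l1_norm M"
    by (simp add: l1_norm_def inner_vec_def SM)
  have \<sigma>2: "\<sigma> * \<sigma> = 1" and \<sigma>M: "\<sigma> * M $ i $ j = m"
    using S1[of i j] SM[of i j] by (auto simp: \<sigma>_def m_def abs_if split: if_splits)
  have n: "sqrt (real CARD('n)) \<ge> 1"
    by (simp add: Suc_leI)
  have m01: "0 \<le> m" "m \<le> 1"
    using abs_entry_le_1[OF orth] by (simp_all add: m_def)
  have "1 \<le> m * (2 * sqrt (real CARD('n)))"
  proof (cases "m = 1")
    \<comment> \<open>Here \<open>e\<close> and \<open>v\<close> coincide and span no plane, but the
      bound is trivial.\<close>
    case True
    then show ?thesis
      using n unfolding True by linarith
  next
    case False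
    define q where "q = sqrt (1 - m\<^sup>2)"
    have "m\<^sup>2 < 1"
      using m01 False by (simp add: power_less_one_iff abs_square_less_1)
    then have q0: "q > 0" and q2: "q * q = 1 - m * m"
      by (simp_all add: q_def power2_eq_square)
    \<comment> \<open>Gram-Schmidt: v = m e + q u, with m and q the cosine and sine of the angle
      between \<open>e\<close> and \<open>v\<close>.\<close>
    define u where "u = (1 / q) *\<^sub>R (v - m *\<^sub>R e)"
    have ee: "e \<bullet> e = 1"
      by (simp add: e_def inner_axis_axis)
    have ev: "e \<bullet> v = m"
      by (simp add: e_def v_def inner_axis' \<sigma>M)
    have vv: "v \<bullet> v = 1"
      using orth by (simp add: v_def orthogonal_matrix_iff_rows \<sigma>2)
    have ve: "v \<bullet> e = m"
      using ev by (simp add: inner_commute)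
    have eu: "e \<bullet> u = 0"
      by (simp add: u_def inner_diff_right ee ev)
    have uu: "u \<bullet> u = 1"
    proof -
      have "u \<bullet> u = (1 - m * m) / (q * q)"
        by (simp add: u_def inner_diff_right inner_diff_left ee ev ve vv)
      then show ?thesis
        using q0 by (simp add: q2[symmetric])
    qed
    have uv: "u \<bullet> v = q"
    proof -
      have "u \<bullet> v = (1 - m * m) / q"
        by (simp add: u_def inner_diff_left ev vv)
      then show ?thesis
        using q0 by (simp add: q2[symmetric])
    qed
    define \<tau> where "\<tau> = P e e + P u u"
    define \<kappa> where "\<kappa> = P u e - P e u"

    have rotS: "(\<Sum>l\<in>UNIV. S $ l \<bullet> plane_rot c s e u (M $ l)) = l1_norm M + (c - 1) * \<tau> + s * \<kappa>"
      for c s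
      by (simp add: pairing_plane_rot pairM \<tau>_def \<kappa>_def P_def)
    have bound: "(\<Sum>l\<in>UNIV. Q $ l \<bullet> plane_rot c s e u (M $ l)) \<le> l1_norm M"
      if "sign_matrix Q" "c\<^sup>2 + s\<^sup>2 = 1" for Q :: "real^'n^'n" and c s
      using sign_matrix_pairing_le[OF that(1), of "\<chi> l. plane_rot c s e u (M $ l)"]
        max[OF orthogonal_matrix_plane_rot[OF orth ee uu eu that(2)]] by simp

    \<comment> \<open>The identity rotation, c = 1 and s = 0, is already optimal for
      \<open>S\<close>, which forces the antisymmetric part \<kappa> to vanish.\<close>
    have "\<tau> * c + \<kappa> * s \<le> \<tau>" if "c\<^sup>2 + s\<^sup>2 = 1" for c s
      using bound[OF signS that] by (simp add: rotS algebra_simps)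
    then have "\<tau>\<^sup>2 + \<kappa>\<^sup>2 \<le> \<tau>\<^sup>2"
      by (rule trig_bound_imp_squares)
    then have \<kappa>: "\<kappa> = 0"
      by simp

    have rotT: "(\<Sum>l\<in>UNIV. T $ l \<bullet> plane_rot c s e u (M $ l))
        = l1_norm M + (c - 1) * \<tau> - 2 * (c * m - s * q)" for c s
    proof -
      have T: "T $ l = S $ l - (if l = i then (2 * \<sigma>) *\<^sub>R e else 0)" for l
        by (auto simp: vec_eq_iff T_def \<sigma>_def e_def axis_def)
      \<comment> \<open>Flipping the sign costs twice this signed (i, j) entry of the rotated
        matrix; it is computed from v = m e + q u.\<close>
      have "\<sigma> * (e \<bullet> plane_rot c s e u (M $ i)) = e \<bullet> plane_rot c s e u v"
        by (simp add: plane_rot_def v_def inner_add_right algebra_simps)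
      also have "\<dots> = c * m - s * q"
        by (simp add: plane_rot_def inner_add_right ee eu ev uv algebra_simps)
      finally have flip: "\<sigma> * (e \<bullet> plane_rot c s e u (M $ i)) = c * m - s * q" .
      have "(\<Sum>l\<in>UNIV. T $ l \<bullet> plane_rot c s e u (M $ l))
          = (\<Sum>l\<in>UNIV. S $ l \<bullet> plane_rot c s e u (M $ l))
            - (\<Sum>l\<in>UNIV. if l = i then 2 * (\<sigma> * (e \<bullet> plane_rot c s e u (M $ l))) else 0)"
        unfolding T inner_diff_left sum_subtractf
        by (intro arg_cong2[where f = minus] sum.cong) auto
      then show ?thesis
        by (simp add: rotS \<kappa> flip)
    qed
    have "(\<tau> - 2 * m) * c + (2 * q) * s \<le> \<tau>" if "c\<^sup>2 + s\<^sup>2 = 1" for c s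
      using bound[OF signT that] by (simp add: rotT algebra_simps)
    then have "(\<tau> - 2 * m)\<^sup>2 + (2 * q)\<^sup>2 \<le> \<tau>\<^sup>2"
      by (rule trig_bound_imp_squares)
    \<comment> \<open>After expansion \<tau>^2 cancels, and m^2 + q^2 = 1 leaves 4 \<le> 4 \<tau>
      m.\<close>
    then have \<tau>m: "1 \<le> \<tau> * m"
      using q2 by (simp add: power2_eq_square algebra_simps)

    have Pev: "P e v = 1"
      by (simp add: P_def v_def cross_form_linear cross_form_row[OF orth])
        (simp add: e_def inner_axis' \<sigma>_def[symmetric] \<sigma>2)
    \<comment> \<open>\<kappa> = 0 makes \<open>P\<close> symmetric on the plane, so this value
      equals \<open>P e v\<close>.\<close>
    have Pve: "P v e = 1"
      using \<kappa> q0 Pev by (simp add: \<kappa>_def u_def P_def cross_form_linear field_simps)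
    \<comment> \<open>\<open>P v v\<close> is the 1-norm of row i; \<open>P e e\<close> below is
      that of column j.\<close>
    have "P v v = \<sigma> * \<sigma> * (M $ i \<bullet> S $ i)"
      by (simp add: P_def v_def cross_form_linear cross_form_row[OF orth])
    also have "\<dots> \<le> sqrt (real CARD('n))"
      using orth sum_signs_le[of "S $ i" "M $ i"]
      by (simp add: \<sigma>2 S1 orthogonal_matrix_iff_rows norm_eq_1 inner_commute)
    finally have Pvv: "P v v \<le> sqrt (real CARD('n))" .
    have "P e e = column j S \<bullet> column j M"
      by (simp add: P_def cross_form_def e_def inner_axis') (simp add: inner_vec_def column_def)
    also have "\<dots> \<le> sqrt (real CARD('n))"
      using orth
      by (intro sum_signs_le) (simp_all add: column_def S1 orthogonal_matrix_orthonormal_columns)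
    finally have Pee: "P e e \<le> sqrt (real CARD('n))" .

    have "P u u = (P v v - 2 * m + m * m * P e e) / (q * q)"
      using Pev Pve q0 by (simp add: u_def P_def cross_form_linear field_simps)
    then have "q * q * P u u = P v v - 2 * m + m * m * P e e"
      using q0 by simp
    \<comment> \<open>Since q^2 = 1 - m^2, the two terms m^2 \<open>P e e\<close> cancel.\<close>
    then have q\<tau>: "q * q * \<tau> = P e e + P v v - 2 * m"
      by (simp add: \<tau>_def q2 algebra_simps)
    have "q * q * 1 \<le> q * q * \<tau> * m"
      unfolding mult.assoc[of "q * q"] using \<tau>m q0 by (intro mult_left_mono) simp_all
    then have "1 - m * m \<le> (P e e + P v v - 2 * m) * m"
      unfolding q\<tau> by (simp add: q2)
    then have "1 + m * m \<le> m * (P e e + P v v)"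
      by (simp add: algebra_simps)
    also have "\<dots> \<le> m * (2 * sqrt (real CARD('n)))"
      using Pee Pvv m01 by (intro mult_left_mono) simp_all
    finally show ?thesis
      using zero_le_square[of m] by linarith
  qed
  then show ?thesis
    using n by (simp add: m_def divide_le_eq)
qed

theorem theorem2p2:
  shows "l_max TYPE('n::finite) \<ge> 1 / (2 * sqrt (real CARD('n)))"
proof -
  have entries: "{\<bar>M $ i $ j\<bar> | i j. True} = (\<lambda>(i, j). \<bar>M $ i $ j\<bar>) ` UNIV" for M :: "real^'n^'n"
    by auto
  have fin: "finite {\<bar>M $ i $ j\<bar> | i j. True}" for M :: "real^'n^'n"
    unfolding entries by simp
  obtain M :: "real^'n^'n" where M: "orthogonal_matrix M"
    "\<And>N :: real^'n^'n. orthogonal_matrix N \<Longrightarrow> l1_norm N \<le> l1_norm M"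
    using ex_l1_norm_maximizer by blast
  have "1 / (2 * sqrt (real CARD('n))) \<le> min_abs_entry M"
    unfolding min_abs_entry_def
    by (rule Min.boundedI[OF fin]) (auto intro: maximizer_entry_bound[OF M])
  also have "\<dots> \<le> l_max TYPE('n)"
    unfolding l_max_def
  proof (rule cSUP_upper)
    \<comment> \<open>The supremum dominates its members only if the set is bounded above; any one
      entry, here at an arbitrary index, supplies the bound 1.\<close>
    have "min_abs_entry N \<le> 1" if "orthogonal_matrix N" for N :: "real^'n^'n"
    proof -
      have "min_abs_entry N \<le> \<bar>N $ undefined $ undefined\<bar>"
        unfolding min_abs_entry_def by (rule Min_le[OF fin]) blast
      then show ?thesis
        using abs_entry_le_1[OF that, of undefined undefined] by linarith
    qed
    then show "bdd_above (min_abs_entry ` {N :: real^'n^'n. orthogonal_matrix N})"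
      by (auto intro!: bdd_aboveI2)
  qed (simp add: M)
  finally show ?thesis .
qed

end
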